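(* Let $H=(\Gamma,D,G,R,F)$ be a hybrid system such that guards of edges with a common source are disjoint, and let $\binom{f_d}{f_c}\colon\binom SM\rightrightarrows\mathcal H\binom SM$ be the $\mathcal H$-coalgebra associated with $H$. Let $\binom{\psi_d}{\psi_c}\colon\binom\Lambda{\bigsqcup_\Lambda I_j}\rightrightarrows\binom SM$ be a chart, where $I_j=[\tau_j,\tau_{j+1}]$, and set $\rho(j)=\psi_d(j,j,\tau_j)$ and $c_j(t)=\psi_c(j,t)$ for $t\in I_j$. Then $\binom{\psi_d}{\psi_c}$ is an $\mathcal H$-coalgebra morphism from the unit clock coalgebra on $\binom\Lambda{\bigsqcup_\Lambda I_j}$ to $\binom{f_d}{f_c}$ if and only if for all $j,j+1\in\Lambda$: $$\frac{d}{dt}c_j(t)=f_{\rho(j)}(c_j(t)),\qquad c_j(\tau_{j+1})\in G_{(\rho(j),\rho(j+1))},\qquad c_{j+1}(\tau_{j+1})=R_{(\rho(j),\rho(j+1))}(c_j(\tau_{j+1})).$$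
   Context: Manifolds are smooth, possibly with boundary; $\mathcal T$ is the tangent bundle functor, $\mathcal P$ the covariant powerset functor, $\underline M$ the underlying set of $M$. Category $\mathsf{Chart}$: objects are pairs $\binom SM$ with $S$ a set and $M$ a manifold. A morphism (chart) $\binom{f_d}{f_c}\colon\binom SM\rightrightarrows\binom{S'}{M'}$ is a smooth map $f_c\colon M\to M'$ and a function $f_d\colon S\times\underline M\to S'$. Composition: $(g\circ f)_c=g_c\circ f_c$, $(g\circ f)_d(s,x)=g_d(f_d(s,x),f_c(x))$. Endofunctor $\mathcal H$: $\mathcal H\binom SM=\binom{\mathcal P(S\times\underline M)}{\mathcal TM}$, $(\mathcal Hf)_c=\mathcal Tf_c$, $(\mathcal Hf)_d(A,v)=\{(f_d(s,x),f_c(x))\mid(s,x)\in A\}$. An $\mathcal H$-coalgebra is a chart $\binom SM\rightrightarrows\mathcal H\binom SM$. A coalgebra morphism from $f$ to $g$ is a chart $\phi$ with $g\circ\phi=\mathcal H(\phi)\circ f$. Hybrid system $H=(\Gamma,D,G,R,F)$: $\Gamma=(V,E)$ is a directed graph with source and target maps $s,t\colon E\to V$; $D=\{D_v\}_{v\in V}$ are smooth manifolds; $G=\{G_e\}_{e\in E}$ are guards $G_e\subseteq D_{s(e)}$; $R=\{R_e\}$ are smooth resets $R_e\colon G_e\to D_{t(e)}$; $F=\{f_v\}$ are vector fields $f_v\colon D_v\to\mathcal TD_v$. Edges are written $e=(v,v')$ with $v=s(e)$, $v'=t(e)$. Associated $\mathcal H$-coalgebra: $S=V$, $M=\bigsqcup_{v\in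 V}D_v$, $f_c=\bigsqcup_vf_v$, and $f_d(v,x)=\{(t(e),R_e(x))\}$ if $x\in G_e$ for an edge $e$ with $s(e)=v$ (unique by disjointness), $f_d(v,x)=\emptyset$ otherwise. An execution of $H$ is a tuple $(\Lambda,I,\rho,C)$ with $I=\{I_j=[\tau_j,\tau_{j+1}]\}_{j\in\Lambda}$, $\rho\colon\Lambda\to V$, $C=\{c_j\colon I_j\to D_{\rho(j)}\}_{j\in\Lambda}$ satisfying the three displayed conditions. Unit clock coalgebra: $\Lambda$ is $\mathbb N$ or $\{0,\dots,n-1\}$; elements of $\Lambda\times\underline{\bigsqcup_\Lambda I_j}$ are written $(j,k,t)$ with $t\in I_k$; $1_c$ is the constant unit vector field on each $I_j$, and $1_d(j,k,t)=\{(j+1,j+1,\tau_{j+1})\}$ if $j=k$, $j+1\in\Lambda$ and $t=\tau_{j+1}$, and $\emptyset$ otherwise.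
   Formalization: Repaired: assumes ψ_c(0,τ_0) lies in D_{ρ(0)}; the right side also requires ψ_d(j,j,τ_{j+1})=ρ(j) whenever j+1∈Λ and f_d(ψ_d(j,k,t),ψ_c(k,t))=∅ off the clock's jump points; the ODE is required for every j∈Λ. *)

theory Defs
  imports "HOL-Analysis.Analysis" "Graph_Theory.Digraph"
begin

section \<open>Smooth functions on subsets of Euclidean spaces\<close>

text \<open>
  Dimensions vary from chart to chart, so the n-dimensional space is the library's
  \<^const>\<open>Euclidean_space\<close>, which consists of the real sequences vanishing from index n on.
\<close>

primrec C_k :: "nat \<Rightarrow> nat \<Rightarrow> (nat \<Rightarrow> real) set \<Rightarrow> ((nat \<Rightarrow> real) \<Rightarrow> real) \<Rightarrow> bool" where
  "C_k n 0 U f \<longleftrightarrow> continuous_on U f"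
| "C_k n (Suc k) U f \<longleftrightarrow> continuous_on U f \<and>
     (\<forall>i<n. \<exists>g. (\<forall>x\<in>U. ((\<lambda>s. f (x(i := s))) has_real_derivative g x) (at (x i))) \<and> C_k n k U g)"

text \<open>Smoothness on an arbitrary subset means existence of local smooth extensions.\<close>

definition smooth_on_Rn :: "nat \<Rightarrow> (nat \<Rightarrow> real) set \<Rightarrow> ((nat \<Rightarrow> real) \<Rightarrow> real) \<Rightarrow> bool" where
  "smooth_on_Rn n A f \<longleftrightarrow> A \<subseteq> topspace (Euclidean_space n) \<and>
     (\<forall>x\<in>A. \<exists>U g. openin (Euclidean_space n) U \<and> x \<in> U \<and> (\<forall>k. C_k n k U g) \<and>
        (\<forall>y\<in>A \<inter> U. f y = g y))"

definition half_space :: "nat \<Rightarrow> (nat \<Rightarrow> real) topology" where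
  "half_space n = subtopology (Euclidean_space n) {x. 0 \<le> x 0}"

section \<open>Manifolds with boundary\<close>

text \<open>
  Coordinate charts may have different dimensions and second countability is not required,
  since neither purity of dimension nor second countability is inherited by the disjoint union
  of an arbitrary family of manifolds. The half space of dimension 0 is a single point.
\<close>

record 'a coordinates =
  cdim :: nat
  cdom :: "'a set"
  cmap :: "'a \<Rightarrow> nat \<Rightarrow> real"

record 'a manifold =
  mtop :: "'a topology"
  atlas :: "'a coordinates set"

abbreviation mcarrier :: "'a manifold \<Rightarrow> 'a set" where
  "mcarrier M \<equiv> topspace (mtop M)"

abbreviation cinv :: "'a coordinates \<Rightarrow> (nat \<Rightarrow> real) \<Rightarrow> 'a" where
  "cinv c \<equiv> inv_into (cdom c) (cmap c)"

definition manifold :: "'a manifold \<Rightarrow> bool" where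
  "manifold M \<longleftrightarrow>
     Hausdorff_space (mtop M) \<and>
     mcarrier M = (\<Union>c\<in>atlas M. cdom c) \<and>
     (\<forall>c\<in>atlas M. openin (mtop M) (cdom c) \<and>
        openin (half_space (cdim c)) (cmap c ` cdom c) \<and>
        homeomorphic_map (subtopology (mtop M) (cdom c))
          (subtopology (half_space (cdim c)) (cmap c ` cdom c)) (cmap c)) \<and>
     (\<forall>c\<in>atlas M. \<forall>d\<in>atlas M. \<forall>i<cdim d.
        smooth_on_Rn (cdim c) (cmap c ` (cdom c \<inter> cdom d)) (\<lambda>y. cmap d (cinv c y) i))"

definition smooth_on :: "'a manifold \<Rightarrow> 'a set \<Rightarrow> 'b manifold \<Rightarrow> ('a \<Rightarrow> 'b) \<Rightarrow> bool" where
  "smooth_on M A N F \<longleftrightarrow> A \<subseteq> mcarrier M \<and>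
     continuous_map (subtopology (mtop M) A) (mtop N) F \<and>
     (\<forall>c\<in>atlas M. \<forall>d\<in>atlas N. \<forall>i<cdim d.
        smooth_on_Rn (cdim c) (cmap c ` (A \<inter> cdom c \<inter> F -` cdom d))
          (\<lambda>y. cmap d (F (cinv c y)) i))"

abbreviation smooth_map :: "'a manifold \<Rightarrow> 'b manifold \<Rightarrow> ('a \<Rightarrow> 'b) \<Rightarrow> bool" where
  "smooth_map M N F \<equiv> smooth_on M (mcarrier M) N F"

definition smooth_near :: "'a manifold \<Rightarrow> 'a \<Rightarrow> ('a \<Rightarrow> real) \<Rightarrow> bool" where
  "smooth_near M p g \<longleftrightarrow> (\<exists>W. openin (mtop M) W \<and> p \<in> W \<and>
     (\<forall>c\<in>atlas M. smooth_on_Rn (cdim c) (cmap c ` (W \<inter> cdom c)) (\<lambda>y. g (cinv c y))))"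

section \<open>The tangent bundle functor\<close>

text \<open>
  Tangent vectors are the derivations of the algebra of germs at a point. Since HOL functions
  are total, a derivation takes the value 0 on functions not smooth near the point, so
  that equal tangent vectors are equal as functions.
\<close>

definition tangent_vector :: "'a manifold \<Rightarrow> 'a \<Rightarrow> (('a \<Rightarrow> real) \<Rightarrow> real) \<Rightarrow> bool" where
  "tangent_vector M p v \<longleftrightarrow> p \<in> mcarrier M \<and>
     (\<forall>g. \<not> smooth_near M p g \<longrightarrow> v g = 0) \<and>
     (\<forall>g h W. smooth_near M p g \<longrightarrow> openin (mtop M) W \<longrightarrow> p \<in> W \<longrightarrow> (\<forall>q\<in>W. g q = h q) \<longrightarrow>
        v g = v h) \<and>
     (\<forall>a g. smooth_near M p g \<longrightarrow> v (\<lambda>q. a * g q) = a * v g) \<and>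
     (\<forall>g h. smooth_near M p g \<longrightarrow> smooth_near M p h \<longrightarrow>
        v (\<lambda>q. g q + h q) = v g + v h \<and>
        v (\<lambda>q. g q * h q) = v g * h p + g p * v h)"

type_synonym 'a tangent = "'a \<times> (('a \<Rightarrow> real) \<Rightarrow> real)"

definition tangent_coordinates :: "'a manifold \<Rightarrow> 'a coordinates \<Rightarrow> 'a tangent coordinates" where
  "tangent_coordinates M c =
     \<lparr>cdim = 2 * cdim c,
      cdom = {(p, v). p \<in> cdom c \<and> tangent_vector M p v},
      cmap = (\<lambda>(p, v) i. if i < cdim c then cmap c p i
                else if i < 2 * cdim c then v (\<lambda>q. cmap c q (i - cdim c)) else 0)\<rparr>"

definition tangent_bundle :: "'a manifold \<Rightarrow> 'a tangent manifold" where
  "tangent_bundle M =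
     \<lparr>mtop = topology_generated_by
        {cdom C \<inter> cmap C -` B | C B. C \<in> tangent_coordinates M ` atlas M \<and>
           openin (half_space (cdim C)) B},
      atlas = tangent_coordinates M ` atlas M\<rparr>"

definition tangent_map :: "'b manifold \<Rightarrow> ('a \<Rightarrow> 'b) \<Rightarrow> 'a tangent \<Rightarrow> 'b tangent" where
  "tangent_map N F = (\<lambda>(p, v). (F p, \<lambda>g. if smooth_near N (F p) g then v (g \<circ> F) else 0))"

definition vector_field :: "'a manifold \<Rightarrow> ('a \<Rightarrow> 'a tangent) \<Rightarrow> bool" where
  "vector_field M X \<longleftrightarrow> smooth_map M (tangent_bundle M) X \<and> (\<forall>p\<in>mcarrier M. fst (X p) = p)"

section \<open>Disjoint unions and intervals\<close>

definition disjoint_union :: "'i set \<Rightarrow> ('i \<Rightarrow> 'a manifold) \<Rightarrow> ('i \<times> 'a) manifold" where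
  "disjoint_union I M =
     \<lparr>mtop = sum_topology (\<lambda>i. mtop (M i)) I,
      atlas = {\<lparr>cdim = cdim c, cdom = {i} \<times> cdom c, cmap = cmap c \<circ> snd\<rparr> | i c.
                 i \<in> I \<and> c \<in> atlas (M i)}\<rparr>"

definition union_field ::
    "'i set \<Rightarrow> ('i \<Rightarrow> 'a manifold) \<Rightarrow> ('i \<Rightarrow> 'a \<Rightarrow> 'a tangent) \<Rightarrow> 'i \<times> 'a \<Rightarrow> ('i \<times> 'a) tangent" where
  "union_field I M X = (\<lambda>(i, x). tangent_map (disjoint_union I M) (Pair i) (X i x))"

definition interval_manifold :: "real \<Rightarrow> real \<Rightarrow> real manifold" where
  "interval_manifold a b =
     \<lparr>mtop = top_of_set {a..b},
      atlas = {\<lparr>cdim = 1, cdom = {a..<b}, cmap = (\<lambda>t i. if i = 0 then t - a else 0)\<rparr>,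
               \<lparr>cdim = 1, cdom = {a<..b}, cmap = (\<lambda>t i. if i = 0 then b - t else 0)\<rparr>}\<rparr>"

definition unit_field :: "real \<Rightarrow> real \<Rightarrow> real \<Rightarrow> real tangent" where
  "unit_field a b t = (t, \<lambda>g. if smooth_near (interval_manifold a b) t g
                              then vector_derivative g (at t within {a..b}) else 0)"

section \<open>Charts and coalgebras\<close>

type_synonym ('s, 'm) chart_object = "'s set \<times> 'm manifold"

record ('s, 'm, 't, 'n) chart =
  dpart :: "'s \<times> 'm \<Rightarrow> 't"
  cpart :: "'m \<Rightarrow> 'n"

definition is_chart ::
    "('s, 'm) chart_object \<Rightarrow> ('t, 'n) chart_object \<Rightarrow> ('s, 'm, 't, 'n) chart \<Rightarrow> bool" where
  "is_chart A B f \<longleftrightarrow> smooth_map (snd A) (snd B) (cpart f) \<and>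
     dpart f \<in> fst A \<times> mcarrier (snd A) \<rightarrow> fst B"

text \<open>Charts are represented by total functions, so equality is relative to the source.\<close>

definition chart_eq ::
    "('s, 'm) chart_object \<Rightarrow> ('s, 'm, 't, 'n) chart \<Rightarrow> ('s, 'm, 't, 'n) chart \<Rightarrow> bool" where
  "chart_eq A f g \<longleftrightarrow> (\<forall>x\<in>mcarrier (snd A). cpart f x = cpart g x) \<and>
     (\<forall>s\<in>fst A. \<forall>x\<in>mcarrier (snd A). dpart f (s, x) = dpart g (s, x))"

definition chart_comp ::
    "('t, 'n, 'u, 'k) chart \<Rightarrow> ('s, 'm, 't, 'n) chart \<Rightarrow> ('s, 'm, 'u, 'k) chart" where
  "chart_comp g f = \<lparr>dpart = (\<lambda>(s, x). dpart g (dpart f (s, x), cpart f x)),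
                     cpart = cpart g \<circ> cpart f\<rparr>"

definition H_obj :: "('s, 'm) chart_object \<Rightarrow> (('s \<times> 'm) set, 'm tangent) chart_object" where
  "H_obj A = (Pow (fst A \<times> mcarrier (snd A)), tangent_bundle (snd A))"

text \<open>The target object is a parameter because the tangent map refers to the target manifold.\<close>

definition H_map :: "('t, 'n) chart_object \<Rightarrow> ('s, 'm, 't, 'n) chart \<Rightarrow>
    (('s \<times> 'm) set, 'm tangent, ('t \<times> 'n) set, 'n tangent) chart" where
  "H_map B f = \<lparr>dpart = (\<lambda>(P, v). (\<lambda>(s, x). (dpart f (s, x), cpart f x)) ` P),
                cpart = tangent_map (snd B) (cpart f)\<rparr>"

text \<open>A coalgebra on A is a chart from A to \<^term>\<open>H_obj A\<close>.\<close>

type_synonym ('s, 'm) coalgebra = "('s, 'm, ('s \<times> 'm) set, 'm tangent) chart"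

definition coalgebra_morphism ::
    "('s, 'm) chart_object \<Rightarrow> ('s, 'm) coalgebra \<Rightarrow>
     ('t, 'n) chart_object \<Rightarrow> ('t, 'n) coalgebra \<Rightarrow> ('s, 'm, 't, 'n) chart \<Rightarrow> bool" where
  "coalgebra_morphism A f B g \<phi> \<longleftrightarrow>
     is_chart A B \<phi> \<and> chart_eq A (chart_comp g \<phi>) (chart_comp (H_map B \<phi>) f)"

section \<open>Hybrid systems\<close>

record ('v, 'e, 'a) hybrid_system =
  graph :: "('v, 'e) pre_digraph"
  domains :: "'v \<Rightarrow> 'a manifold"
  guard :: "'e \<Rightarrow> 'a set"
  reset :: "'e \<Rightarrow> 'a \<Rightarrow> 'a"
  vfield :: "'v \<Rightarrow> 'a \<Rightarrow> 'a tangent"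

definition is_hybrid_system :: "('v, 'e, 'a) hybrid_system \<Rightarrow> bool" where
  "is_hybrid_system H \<longleftrightarrow> wf_digraph (graph H) \<and>
     (\<forall>v\<in>verts (graph H). manifold (domains H v) \<and> vector_field (domains H v) (vfield H v)) \<and>
     (\<forall>e\<in>arcs (graph H). guard H e \<subseteq> mcarrier (domains H (tail (graph H) e)) \<and>
        smooth_on (domains H (tail (graph H) e)) (guard H e) (domains H (head (graph H) e)) (reset H e))"

definition disjoint_guards :: "('v, 'e, 'a) hybrid_system \<Rightarrow> bool" where
  "disjoint_guards H \<longleftrightarrow> (\<forall>e\<in>arcs (graph H). \<forall>e'\<in>arcs (graph H).
     tail (graph H) e = tail (graph H) e' \<longrightarrow> e \<noteq> e' \<longrightarrow> guard H e \<inter> guard H e' = {})"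

definition system_object :: "('v, 'e, 'a) hybrid_system \<Rightarrow> ('v, 'v \<times> 'a) chart_object" where
  "system_object H = (verts (graph H), disjoint_union (verts (graph H)) (domains H))"

text \<open>
  A guard of an edge with source v lies in the summand of v; hence the condition w = v below.
  Under disjointness of guards the set of successors has at most one element.
\<close>

definition system_coalgebra :: "('v, 'e, 'a) hybrid_system \<Rightarrow> ('v, 'v \<times> 'a) coalgebra" where
  "system_coalgebra H =
     \<lparr>dpart = (\<lambda>(v, (w, x)). {(head (graph H) e, (head (graph H) e, reset H e x)) | e.
                 e \<in> arcs (graph H) \<and> tail (graph H) e = v \<and> w = v \<and> x \<in> guard H e}),
      cpart = union_field (verts (graph H)) (domains H) (vfield H)\<rparr>"

section \<open>The unit clock\<close>

abbreviation clock_interval :: "(nat \<Rightarrow> real) \<Rightarrow> nat \<Rightarrow> real manifold" where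
  "clock_interval \<tau> j \<equiv> interval_manifold (\<tau> j) (\<tau> (Suc j))"

definition clock_object :: "nat set \<Rightarrow> (nat \<Rightarrow> real) \<Rightarrow> (nat, nat \<times> real) chart_object" where
  "clock_object \<Lambda> \<tau> = (\<Lambda>, disjoint_union \<Lambda> (clock_interval \<tau>))"

definition clock_coalgebra :: "nat set \<Rightarrow> (nat \<Rightarrow> real) \<Rightarrow> (nat, nat \<times> real) coalgebra" where
  "clock_coalgebra \<Lambda> \<tau> =
     \<lparr>dpart = (\<lambda>(j, (k, t)). if j = k \<and> Suc j \<in> \<Lambda> \<and> t = \<tau> (Suc j)
                 then {(Suc j, (Suc j, \<tau> (Suc j)))} else {}),
      cpart = union_field \<Lambda> (clock_interval \<tau>) (\<lambda>j. unit_field (\<tau> j) (\<tau> (Suc j)))\<rparr>"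

end

theory Submission
  imports Defs
begin

text \<open>
  The equation defining a coalgebra morphism splits into a continuous and a discrete half, and
  each half is read off at the points of the clock.

  Continuous half. A chart sends each interval into a single summand, because intervals are
  connected and the summands of a disjoint union are clopen
  (\<open>connected_sum_topology_index\<close>). On the interval with index j the continuous part of the chart
  is therefore an inclusion \<open>Pair w\<close> composed with the curve c j. The tangent map of an inclusion
  into a disjoint union is injective on tangent vectors (\<open>tangent_map_Pair_cancel\<close>), since
  germs at a point of a summand and germs at its image in the union are the same thing
  (\<open>smooth_near_disjoint_union\<close>). By functoriality (\<open>tangent_map_union_unit_field\<close>), the
  continuous half can be tested in the summand, where it says that c j is an integral curve of
  the vector field of w.

  Discrete half. At a switching time of the clock the successor set is the singleton given by the
  next starting point, so the equation says that the guards at the current state admit exactly one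
  successor, namely the next starting point; disjointness of guards makes one admissible edge
  enough. At every other point the clock has no successor, so no guard may be enabled there.

  It remains to see that w is \<open>\<rho> j\<close>. For j = 0 this is the initial condition. For later j an edge
  leading into index j puts its head into both components of the successor, so state and summand
  agree at the start of the interval, hence on all of it.
\<close>

section \<open>Curves in a disjoint union\<close>

lemma connected_sum_topology_index:
  assumes "connected_space X" and f: "continuous_map X (sum_topology Y I) f"
    and "x \<in> topspace X" and "y \<in> topspace X"
  shows "fst (f x) = fst (f y)"
proof -
  let ?A = "\<lambda>J. {z \<in> topspace X. f z \<in> Sigma J (\<lambda>i. topspace (Y i))}"
  have preimage: "openin X (?A J)" if "J \<subseteq> I" for J
  proof -
    have "openin (sum_topology Y I) (Sigma J (\<lambda>i. topspace (Y i)))"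
      using that by (subst openin_sum_topology) (auto simp: Collect_conj_eq)
    then show ?thesis using f by (rule openin_continuous_map_preimage[rotated])
  qed
  have target: "f z \<in> Sigma I (\<lambda>i. topspace (Y i))" if "z \<in> topspace X" for z
    using continuous_map_image_subset_topspace[OF f] that by auto
  define i where "i = fst (f x)"
  have "i \<in> I" using target[OF assms(3)] by (auto simp: i_def)
  have "openin X (?A {i})" "openin X (?A (I - {i}))"
    using preimage \<open>i \<in> I\<close> by auto
  moreover have "topspace X \<subseteq> ?A {i} \<union> ?A (I - {i})"
    using target by force
  moreover have "?A {i} \<inter> ?A (I - {i}) = {}" by auto
  moreover have "x \<in> ?A {i}"
    using assms(3) target[OF assms(3)] by (cases "f x") (simp add: i_def)
  then have "?A {i} \<noteq> {}" by (metis empty_iff)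
  moreover have "\<not> (openin X U \<and> openin X V \<and> topspace X \<subseteq> U \<union> V \<and> U \<inter> V = {} \<and>
      U \<noteq> {} \<and> V \<noteq> {})" for U V
    using assms(1) unfolding connected_space_def by blast
  ultimately have "?A (I - {i}) = {}" by meson
  then have "f y \<notin> Sigma (I - {i}) (\<lambda>i. topspace (Y i))"
    using assms(4) by (metis (mono_tags, lifting) empty_iff mem_Collect_eq)
  then show ?thesis
    using target[OF assms(4)] by (auto simp: i_def)
qed

lemma topspace_disjoint_union:
  "mcarrier (disjoint_union I M) = Sigma I (\<lambda>i. mcarrier (M i))"
  by (simp add: disjoint_union_def comp_def)

lemma topspace_interval_manifold: "mcarrier (interval_manifold a b) = {a..b}"
  by (simp add: interval_manifold_def)

section \<open>Smooth germs\<close>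

lemma smooth_on_Rn_cong:
  assumes "A = B" and "\<And>y. y \<in> B \<Longrightarrow> f y = g y"
  shows "smooth_on_Rn n A f \<longleftrightarrow> smooth_on_Rn n B g"
  using assms by (simp add: smooth_on_Rn_def)

text \<open>
  Inverse coordinate maps are choice functions; injectivity is what makes them genuine inverses.
\<close>

definition injective_atlas :: "'a manifold \<Rightarrow> bool" where
  "injective_atlas M \<longleftrightarrow> (\<forall>c\<in>atlas M. inj_on (cmap c) (cdom c))"

lemma manifold_imp_injective_atlas:
  assumes "manifold M"
  shows "injective_atlas M"
  unfolding injective_atlas_def
proof
  fix c assume "c \<in> atlas M"
  then have "openin (mtop M) (cdom c)"
    and "homeomorphic_map (subtopology (mtop M) (cdom c))
          (subtopology (half_space (cdim c)) (cmap c ` cdom c)) (cmap c)"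
    using assms by (auto simp: manifold_def)
  then show "inj_on (cmap c) (cdom c)"
    using homeomorphic_imp_injective_map openin_subset topspace_subtopology_subset by metis
qed

lemma injective_atlas_interval: "injective_atlas (interval_manifold a b)"
  by (auto simp: injective_atlas_def interval_manifold_def inj_on_def dest: fun_cong[of _ _ 0])

lemma smooth_near_cong:
  assumes "injective_atlas M" and "\<And>q. q \<in> mcarrier M \<Longrightarrow> g q = h q"
  shows "smooth_near M p g \<longleftrightarrow> smooth_near M p h"
proof -
  have "smooth_on_Rn (cdim c) (cmap c ` (W \<inter> cdom c)) (\<lambda>y. g (cinv c y)) \<longleftrightarrow>
        smooth_on_Rn (cdim c) (cmap c ` (W \<inter> cdom c)) (\<lambda>y. h (cinv c y))"
    if "openin (mtop M) W" "c \<in> atlas M" for W c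
  proof (rule smooth_on_Rn_cong[OF refl])
    fix y assume "y \<in> cmap c ` (W \<inter> cdom c)"
    then obtain q where q: "q \<in> W" "q \<in> cdom c" "y = cmap c q" by auto
    moreover have "inj_on (cmap c) (cdom c)"
      using assms(1) that by (auto simp: injective_atlas_def)
    moreover have "q \<in> mcarrier M" using openin_subset[OF that(1)] q by auto
    ultimately show "g (cinv c y) = h (cinv c y)"
      using assms(2) by simp
  qed
  then show ?thesis unfolding smooth_near_def by blast
qed

text \<open>
  The coordinates of the union near a point of the summand i are those of the summand, and a
  neighbourhood inside the summand meets no other coordinate domain.
\<close>

lemma smooth_near_disjoint_union:
  assumes "i \<in> I" and inj: "injective_atlas (M i)"
  shows "smooth_near (disjoint_union I M) (i, x) g \<longleftrightarrow> smooth_near (M i) x (g \<circ> Pair i)"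
proof -
  let ?C = "\<lambda>i c. \<lparr>cdim = cdim c, cdom = {i} \<times> cdom c, cmap = cmap c \<circ> snd\<rparr>"
  let ?sm = "\<lambda>W g c. smooth_on_Rn (cdim c) (cmap c ` (W \<inter> cdom c)) (\<lambda>y. g (cinv c y))"
  have coordinates: "?sm W g (?C i c) \<longleftrightarrow> ?sm {q. (i, q) \<in> W} (g \<circ> Pair i) c"
    if c: "c \<in> atlas (M i)" for W :: "('a \<times> 'b) set" and g c
  proof -
    have inj_c: "inj_on (cmap c) (cdom c)" using inj c by (auto simp: injective_atlas_def)
    have "smooth_on_Rn (cdim c) ((cmap c \<circ> snd) ` (W \<inter> {i} \<times> cdom c))
            (\<lambda>y. g (inv_into ({i} \<times> cdom c) (cmap c \<circ> snd) y)) \<longleftrightarrow>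
          ?sm {q. (i, q) \<in> W} (g \<circ> Pair i) c"
    proof (rule smooth_on_Rn_cong)
      show "(cmap c \<circ> snd) ` (W \<inter> {i} \<times> cdom c) = cmap c ` ({q. (i, q) \<in> W} \<inter> cdom c)"
        by force
    next
      fix y assume "y \<in> cmap c ` ({q. (i, q) \<in> W} \<inter> cdom c)"
      then obtain q where q: "q \<in> cdom c" "y = cmap c q" by auto
      have "inj_on (cmap c \<circ> snd) ({i} \<times> cdom c)"
        using inj_c by (auto simp: inj_on_def)
      then have "inv_into ({i} \<times> cdom c) (cmap c \<circ> snd) ((cmap c \<circ> snd) (i, q)) = (i, q)"
        using q by (intro inv_into_f_f) auto
      then show "g (inv_into ({i} \<times> cdom c) (cmap c \<circ> snd) y) = (g \<circ> Pair i) (cinv c y)"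
        using q inj_c by simp
    qed
    then show ?thesis by simp
  qed
  show ?thesis
  proof
    assume "smooth_near (disjoint_union I M) (i, x) g"
    then obtain W where W: "openin (sum_topology (\<lambda>i. mtop (M i)) I) W" "(i, x) \<in> W"
      and sm: "\<And>C. C \<in> atlas (disjoint_union I M) \<Longrightarrow> ?sm W g C"
      by (auto simp: smooth_near_def disjoint_union_def)
    have "?sm {q. (i, q) \<in> W} (g \<circ> Pair i) c" if "c \<in> atlas (M i)" for c
    proof -
      have "?C i c \<in> atlas (disjoint_union I M)"
        using that assms(1) by (auto simp: disjoint_union_def)
      then show ?thesis using coordinates[OF that] sm by blast
    qed
    moreover have "openin (mtop (M i)) {q. (i, q) \<in> W}"
      using W assms(1) by (auto simp: openin_sum_topology)
    ultimately show "smooth_near (M i) x (g \<circ> Pair i)"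
      using W unfolding smooth_near_def by blast
  next
    assume "smooth_near (M i) x (g \<circ> Pair i)"
    then obtain W where W: "openin (mtop (M i)) W" "x \<in> W"
      and sm: "\<And>c. c \<in> atlas (M i) \<Longrightarrow> ?sm W (g \<circ> Pair i) c"
      by (auto simp: smooth_near_def)
    have "?sm ({i} \<times> W) g C" if C_in: "C \<in> atlas (disjoint_union I M)" for C
    proof -
      obtain k c where C: "C = ?C k c" "k \<in> I" "c \<in> atlas (M k)"
        using C_in by (auto simp: disjoint_union_def)
      show ?thesis
      proof (cases "k = i")
        case True
        then show ?thesis using C coordinates[of c "{i} \<times> W" g] sm[of c] by simp
      next
        case False
        then have "{i} \<times> W \<inter> cdom C = {}" using C by auto
        then show ?thesis by (simp add: smooth_on_Rn_def)
      qed
    qed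
    moreover have "openin (mtop (disjoint_union I M)) ({i} \<times> W)"
    proof -
      have "openin (mtop (M k)) {q. (k, q) \<in> {i} \<times> W}" for k
        using W by (cases "k = i") auto
      moreover have "{i} \<times> W \<subseteq> Sigma I (\<lambda>i. mcarrier (M i))"
        using openin_subset[OF W(1)] assms(1) by auto
      ultimately show ?thesis by (simp add: disjoint_union_def openin_sum_topology comp_def)
    qed
    ultimately show "smooth_near (disjoint_union I M) (i, x) g"
      using W unfolding smooth_near_def by blast
  qed
qed

section \<open>Tangent vectors of a disjoint union\<close>

lemma vector_field_tangent_vector:
  assumes "vector_field M X" and p: "p \<in> mcarrier M"
  obtains v where "X p = (p, v)" and "tangent_vector M p v"
proof -
  have "continuous_map (mtop M) (mtop (tangent_bundle M)) X"
    using assms(1) by (simp add: vector_field_def smooth_on_def)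
  then have "X p \<in> mcarrier (tangent_bundle M)"
    using p continuous_map_image_subset_topspace by fastforce
  then have "tangent_vector M (fst (X p)) (snd (X p))"
    by (auto simp: tangent_bundle_def tangent_coordinates_def)
  moreover have "fst (X p) = p" using assms by (simp add: vector_field_def)
  ultimately show ?thesis using that[of "snd (X p)"] by (metis prod.collapse)
qed

text \<open>
  The maps v and w are compared on a germ h of the summand by testing their images on h composed
  with the projection. Vanishing on functions that are not smooth covers the remaining arguments.
\<close>

lemma tangent_map_Pair_cancel:
  assumes "i \<in> I" and "injective_atlas (M i)"
    and "\<And>g. \<not> smooth_near (M i) x g \<Longrightarrow> v g = 0"
    and "\<And>g. \<not> smooth_near (M i) x g \<Longrightarrow> w g = 0"
  shows "tangent_map (disjoint_union I M) (Pair i) (x, v) =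
           tangent_map (disjoint_union I M) (Pair i) (x, w) \<longleftrightarrow> v = w"
proof
  assume eq: "tangent_map (disjoint_union I M) (Pair i) (x, v) =
    tangent_map (disjoint_union I M) (Pair i) (x, w)"
  show "v = w"
  proof
    fix h
    show "v h = w h"
    proof (cases "smooth_near (M i) x h")
      case True
      have h: "(h \<circ> snd) \<circ> Pair i = h" by auto
      then have "smooth_near (disjoint_union I M) (i, x) (h \<circ> snd)"
        using True smooth_near_disjoint_union[of i I M x "h \<circ> snd"] assms(1,2) by simp
      moreover have "snd (tangent_map (disjoint_union I M) (Pair i) (x, v)) (h \<circ> snd) =
          snd (tangent_map (disjoint_union I M) (Pair i) (x, w)) (h \<circ> snd)"
        using eq by simp
      ultimately show ?thesis using h by (simp add: tangent_map_def)
    next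
      case False
      then show ?thesis using assms(3,4) by simp
    qed
  qed
qed simp

lemma unit_field_cong:
  assumes "t \<in> {a..b}" and "\<And>s. s \<in> {a..b} \<Longrightarrow> g s = h s"
  shows "snd (unit_field a b t) g = snd (unit_field a b t) h"
proof -
  have "(g has_vector_derivative d) (at t within {a..b}) \<longleftrightarrow>
        (h has_vector_derivative d) (at t within {a..b})" for d
    using assms has_vector_derivative_transform[of t "{a..b}"] by metis
  then have "vector_derivative g (at t within {a..b}) = vector_derivative h (at t within {a..b})"
    by (simp add: vector_derivative_def)
  moreover have "smooth_near (interval_manifold a b) t g \<longleftrightarrow>
      smooth_near (interval_manifold a b) t h"
    using assms(2) by (intro smooth_near_cong injective_atlas_interval)
      (simp add: topspace_interval_manifold)
  ultimately show ?thesis by (simp add: unit_field_def)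
qed

text \<open>
  This is functoriality of the tangent map along the two factorisations of a curve whose image
  lies in one summand. The two sides also agree on functions whose pullback to the interval is not
  smooth near t: the tangent map along \<open>Pair j\<close> sends these to 0, and so does the unit vector.
\<close>

lemma tangent_map_union_unit_field:
  fixes \<gamma> :: "'j \<times> real \<Rightarrow> 'i \<times> 'a" and a b :: "'j \<Rightarrow> real"
  assumes "j \<in> J" and "i \<in> I" and "injective_atlas (M i)" and t: "t \<in> {a j..b j}"
    and \<gamma>: "\<And>s. s \<in> {a j..b j} \<Longrightarrow> \<gamma> (j, s) = (i, c s)"
  shows "tangent_map (disjoint_union I M) \<gamma>
           (union_field J (\<lambda>j. interval_manifold (a j) (b j)) (\<lambda>j. unit_field (a j) (b j)) (j, t)) =
         tangent_map (disjoint_union I M) (Pair i)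
           (tangent_map (M i) c (unit_field (a j) (b j) t))"
proof -
  let ?U = "disjoint_union J (\<lambda>j. interval_manifold (a j) (b j))"
  let ?u = "snd (unit_field (a j) (b j) t)"
  have vanish: "?u f = 0" if "\<not> smooth_near (interval_manifold (a j) (b j)) t f" for f
    using that by (simp add: unit_field_def)
  have "(if smooth_near ?U (j, t) (g \<circ> \<gamma>) then ?u (g \<circ> \<gamma> \<circ> Pair j) else 0) =
      ?u (g \<circ> Pair i \<circ> c)" for g
  proof -
    have "?u (g \<circ> \<gamma> \<circ> Pair j) = ?u (g \<circ> Pair i \<circ> c)"
      using \<gamma> by (intro unit_field_cong t) simp
    then show ?thesis
      using vanish smooth_near_disjoint_union[OF assms(1),
          of "\<lambda>j. interval_manifold (a j) (b j)" t "g \<circ> \<gamma>", OF injective_atlas_interval]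
      by (metis (no_types, lifting))
  qed
  moreover have "fst (unit_field (a j) (b j) t) = t" by (simp add: unit_field_def)
  ultimately show ?thesis
    using \<gamma>[OF t] smooth_near_disjoint_union[of i I M "c t"] assms(2,3)
    by (simp add: tangent_map_def union_field_def fun_eq_iff split_beta comp_def
        cong del: if_weak_cong)
qed

text \<open>
  Both sides of the continuous half of the morphism equation come from the summand, where they
  can be compared.
\<close>

lemma integral_curve_in_summand:
  fixes \<gamma> :: "'j \<times> real \<Rightarrow> 'i \<times> 'a" and a b :: "'j \<Rightarrow> real"
  assumes "j \<in> J" and "i \<in> I" and "manifold (M i)" and X: "vector_field (M i) (X i)"
    and t: "t \<in> {a j..b j}" and c: "c t \<in> mcarrier (M i)"
    and \<gamma>: "\<And>s. s \<in> {a j..b j} \<Longrightarrow> \<gamma> (j, s) = (i, c s)"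
  shows "union_field I M X (\<gamma> (j, t)) = tangent_map (disjoint_union I M) \<gamma>
           (union_field J (\<lambda>j. interval_manifold (a j) (b j)) (\<lambda>j. unit_field (a j) (b j)) (j, t))
         \<longleftrightarrow> tangent_map (M i) c (unit_field (a j) (b j) t) = X i (c t)"
proof -
  note inj = manifold_imp_injective_atlas[OF assms(3)]
  obtain v where v: "X i (c t) = (c t, v)" "tangent_vector (M i) (c t) v"
    using vector_field_tangent_vector[OF X c] .
  define w where "w = snd (tangent_map (M i) c (unit_field (a j) (b j) t))"
  have w: "tangent_map (M i) c (unit_field (a j) (b j) t) = (c t, w)"
    by (simp add: w_def tangent_map_def unit_field_def)
  have "union_field I M X (\<gamma> (j, t)) = tangent_map (disjoint_union I M) (Pair i) (c t, v)"
    using \<gamma>[OF t] v by (simp add: union_field_def)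
  moreover have "tangent_map (disjoint_union I M) (Pair i) (c t, v) =
      tangent_map (disjoint_union I M) (Pair i) (c t, w) \<longleftrightarrow> v = w"
  proof (rule tangent_map_Pair_cancel[of i I M, OF assms(2) inj])
    show "v g = 0" if "\<not> smooth_near (M i) (c t) g" for g
      using v that by (simp add: tangent_vector_def)
    show "w g = 0" if "\<not> smooth_near (M i) (c t) g" for g
      using that by (simp add: w_def tangent_map_def unit_field_def)
  qed
  ultimately show ?thesis
    using tangent_map_union_unit_field[of j J i I M, OF assms(1,2) inj, of t a b \<gamma> c] t \<gamma> v w by auto
qed

section \<open>Coalgebra morphisms from the unit clock\<close>

text \<open>
  Disjointness of guards leaves one candidate for the edge that is taken, so that exhibiting an
  enabled edge determines the whole set of successors.
\<close>

lemma successors_eq_singleton_iff: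
  assumes "disjoint_guards H"
  shows "dpart (system_coalgebra H) (v, p) = {(v', p')} \<longleftrightarrow>
    (\<exists>e\<in>arcs (graph H). tail (graph H) e = v \<and> fst p = v \<and> snd p \<in> guard H e \<and>
       v' = head (graph H) e \<and> p' = (head (graph H) e, reset H e (snd p)))"
  (is "?L \<longleftrightarrow> ?R")
proof
  assume ?L
  then have "(v', p') \<in> dpart (system_coalgebra H) (v, p)" by simp
  then show ?R by (auto simp: system_coalgebra_def split: prod.splits)
next
  assume ?R
  then obtain e where e: "e \<in> arcs (graph H)" "tail (graph H) e = v" "fst p = v"
    "snd p \<in> guard H e" "v' = head (graph H) e" "p' = (head (graph H) e, reset H e (snd p))"
    by blast
  have "e' = e" if "e' \<in> arcs (graph H)" "tail (graph H) e' = v" "snd p \<in> guard H e'" for e'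
    using assms e that unfolding disjoint_guards_def by blast
  then have "{(head (graph H) e', (head (graph H) e', reset H e' (snd p))) | e'.
      e' \<in> arcs (graph H) \<and> tail (graph H) e' = v \<and> fst p = v \<and> snd p \<in> guard H e'} =
    {(v', p')}"
    using e by blast
  then show ?L by (simp add: system_coalgebra_def split_beta)
qed

lemma successors_empty_iff:
  "dpart (system_coalgebra H) (v, p) = {} \<longleftrightarrow>
     \<not> (\<exists>e\<in>arcs (graph H). tail (graph H) e = v \<and> p \<in> {tail (graph H) e} \<times> guard H e)"
  by (auto simp: system_coalgebra_def split: prod.splits)


theorem lemma13:
  fixes H :: "('v, 'e, 'a) hybrid_system"
    and \<Lambda> :: "nat set" and \<tau> :: "nat \<Rightarrow> real"
    and \<psi> :: "(nat, nat \<times> real, 'v, 'v \<times> 'a) chart"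
    and \<rho> :: "nat \<Rightarrow> 'v" and c :: "nat \<Rightarrow> real \<Rightarrow> 'a"
  assumes "is_hybrid_system H"
    and "disjoint_guards H"
    and "\<Lambda> = UNIV \<or> (\<exists>n. \<Lambda> = {..<n})"
    and "\<forall>j\<in>\<Lambda>. \<tau> j < \<tau> (Suc j)"
    and "is_chart (clock_object \<Lambda> \<tau>) (system_object H) \<psi>"
    and "\<forall>j\<in>\<Lambda>. \<rho> j = dpart \<psi> (j, (j, \<tau> j))"
    and "\<forall>j\<in>\<Lambda>. \<forall>t\<in>{\<tau> j..\<tau> (Suc j)}. c j t = snd (cpart \<psi> (j, t))"
    and initial: "0 \<in> \<Lambda> \<longrightarrow> fst (cpart \<psi> (0, \<tau> 0)) = \<rho> 0"
  shows "coalgebra_morphism (clock_object \<Lambda> \<tau>) (clock_coalgebra \<Lambda> \<tau>)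
           (system_object H) (system_coalgebra H) \<psi> \<longleftrightarrow>
         (\<forall>j\<in>\<Lambda>. \<forall>t\<in>{\<tau> j..\<tau> (Suc j)}. fst (cpart \<psi> (j, t)) = \<rho> j \<and>
            tangent_map (domains H (\<rho> j)) (c j) (unit_field (\<tau> j) (\<tau> (Suc j)) t)
              = vfield H (\<rho> j) (c j t)) \<and>
         (\<forall>j. j \<in> \<Lambda> \<and> Suc j \<in> \<Lambda> \<longrightarrow>
            (\<exists>e\<in>arcs (graph H). tail (graph H) e = \<rho> j \<and> head (graph H) e = \<rho> (Suc j) \<and>
               c j (\<tau> (Suc j)) \<in> guard H e \<and>
               c (Suc j) (\<tau> (Suc j)) = reset H e (c j (\<tau> (Suc j))))) \<and>
         (\<forall>j. j \<in> \<Lambda> \<and> Suc j \<in> \<Lambda> \<longrightarrow> dpart \<psi> (j, (j, \<tau> (Suc j))) = \<rho> j) \<and>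
         (\<forall>j\<in>\<Lambda>. \<forall>k\<in>\<Lambda>. \<forall>t\<in>{\<tau> k..\<tau> (Suc k)}.
            \<not> (j = k \<and> Suc j \<in> \<Lambda> \<and> t = \<tau> (Suc j)) \<longrightarrow>
            \<not> (\<exists>e\<in>arcs (graph H). tail (graph H) e = dpart \<psi> (j, (k, t)) \<and>
                  cpart \<psi> (k, t) \<in> {tail (graph H) e} \<times> guard H e))"
proof -
  let ?V = "verts (graph H)" and ?D = "domains H" and ?I = "\<lambda>j. {\<tau> j..\<tau> (Suc j)}"
  let ?cont = "\<lambda>j t. cpart (system_coalgebra H) (cpart \<psi> (j, t)) =
    tangent_map (disjoint_union ?V ?D) (cpart \<psi>) (cpart (clock_coalgebra \<Lambda> \<tau>) (j, t))"
  let ?succ = "\<lambda>j p. dpart (system_coalgebra H) (dpart \<psi> (j, p), cpart \<psi> p)"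
  let ?jump = "\<lambda>j. ?succ j (j, \<tau> (Suc j)) = {(\<rho> (Suc j), cpart \<psi> (Suc j, \<tau> (Suc j)))}"
  let ?edge = "\<lambda>j. \<exists>e\<in>arcs (graph H). tail (graph H) e = \<rho> j \<and> head (graph H) e = \<rho> (Suc j) \<and>
     c j (\<tau> (Suc j)) \<in> guard H e \<and> c (Suc j) (\<tau> (Suc j)) = reset H e (c j (\<tau> (Suc j)))"
  let ?quiet = "\<forall>j\<in>\<Lambda>. \<forall>k\<in>\<Lambda>. \<forall>t\<in>?I k. \<not> (j = k \<and> Suc j \<in> \<Lambda> \<and> t = \<tau> (Suc j)) \<longrightarrow>
     ?succ j (k, t) = {}"
  have less: "\<tau> j < \<tau> (Suc j)" if "j \<in> \<Lambda>" for j using assms(4) that by blast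
  have prev: "j \<in> \<Lambda>" if "Suc j \<in> \<Lambda>" for j using assms(3) that by auto
  have c: "c j t = snd (cpart \<psi> (j, t))" if "j \<in> \<Lambda>" "t \<in> ?I j" for j t
    using assms(7) that by blast
  have \<rho>: "dpart \<psi> (j, (j, \<tau> j)) = \<rho> j" if "j \<in> \<Lambda>" for j using assms(6) that by simp
  have carrier: "mcarrier (disjoint_union \<Lambda> (clock_interval \<tau>)) = Sigma \<Lambda> ?I"
    by (simp add: topspace_disjoint_union topspace_interval_manifold)
  have cont: "continuous_map (mtop (disjoint_union \<Lambda> (clock_interval \<tau>)))
      (sum_topology (\<lambda>v. mtop (?D v)) ?V) (cpart \<psi>)"
    using assms(5)
    by (simp only: is_chart_def smooth_on_def clock_object_def system_object_def fst_conv snd_conv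
        subtopology_topspace) (simp add: disjoint_union_def)
  have target: "fst (cpart \<psi> (j, t)) \<in> ?V \<and>
      snd (cpart \<psi> (j, t)) \<in> mcarrier (?D (fst (cpart \<psi> (j, t))))" if "j \<in> \<Lambda>" "t \<in> ?I j" for j t
  proof -
    have "(j, t) \<in> mcarrier (disjoint_union \<Lambda> (clock_interval \<tau>))" using that carrier by simp
    then have "cpart \<psi> (j, t) \<in> Sigma ?V (\<lambda>v. mcarrier (?D v))"
      using continuous_map_image_subset_topspace[OF cont] by auto
    then show ?thesis by (auto simp: split_beta)
  qed
  have summand: "fst (cpart \<psi> (j, t)) = fst (cpart \<psi> (j, s))"
    if "j \<in> \<Lambda>" "t \<in> ?I j" "s \<in> ?I j" for j t s
  proof -
    have "continuous_map (mtop (clock_interval \<tau> j))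
        (mtop (disjoint_union \<Lambda> (clock_interval \<tau>))) (Pair j)"
      using that continuous_map_component_injection[of j \<Lambda> "\<lambda>j. mtop (clock_interval \<tau> j)"]
      by (simp add: disjoint_union_def)
    from continuous_map_compose[OF this cont]
    have "continuous_map (top_of_set (?I j)) (sum_topology (\<lambda>v. mtop (?D v)) ?V)
        (cpart \<psi> \<circ> Pair j)"
      by (simp add: interval_manifold_def)
    from connected_sum_topology_index[OF _ this, of t s] show ?thesis
      using that by (simp add: connected_space_subtopology)
  qed
  have morphism: "coalgebra_morphism (clock_object \<Lambda> \<tau>) (clock_coalgebra \<Lambda> \<tau>)
      (system_object H) (system_coalgebra H) \<psi> \<longleftrightarrow>
      (\<forall>j\<in>\<Lambda>. \<forall>t\<in>?I j. ?cont j t) \<and> (\<forall>j. j \<in> \<Lambda> \<and> Suc j \<in> \<Lambda> \<longrightarrow> ?jump j) \<and> ?quiet"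
    (is "_ \<longleftrightarrow> ?C \<and> ?J \<and> ?Q")
  proof -
    have "coalgebra_morphism (clock_object \<Lambda> \<tau>) (clock_coalgebra \<Lambda> \<tau>)
        (system_object H) (system_coalgebra H) \<psi> \<longleftrightarrow>
        ?C \<and> (\<forall>j\<in>\<Lambda>. \<forall>k\<in>\<Lambda>. \<forall>t\<in>?I k. ?succ j (k, t) =
          (if j = k \<and> Suc j \<in> \<Lambda> \<and> t = \<tau> (Suc j)
           then {(dpart \<psi> (Suc j, (Suc j, \<tau> (Suc j))), cpart \<psi> (Suc j, \<tau> (Suc j)))} else {}))"
      (is "_ \<longleftrightarrow> ?C \<and> ?S")
      using assms(5)
      by (simp add: coalgebra_morphism_def chart_eq_def chart_comp_def H_map_def
          clock_object_def system_object_def carrier clock_coalgebra_def if_distrib cong: if_cong)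
    moreover have "?S \<longleftrightarrow> ?J \<and> ?Q"
    proof
      assume S: ?S
      have "?jump j" if "j \<in> \<Lambda>" "Suc j \<in> \<Lambda>" for j
        using bspec[OF bspec[OF bspec[OF S that(1)] that(1)], of "\<tau> (Suc j)"]
          that less[OF that(1)] \<rho>[OF that(2)] by simp
      moreover have ?Q using S by auto
      ultimately show "?J \<and> ?Q" by blast
    next
      assume JQ: "?J \<and> ?Q"
      show ?S
      proof (intro ballI)
        fix j k t assume jkt: "j \<in> \<Lambda>" "k \<in> \<Lambda>" "t \<in> ?I k"
        show "?succ j (k, t) = (if j = k \<and> Suc j \<in> \<Lambda> \<and> t = \<tau> (Suc j)
            then {(dpart \<psi> (Suc j, (Suc j, \<tau> (Suc j))), cpart \<psi> (Suc j, \<tau> (Suc j)))} else {})"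
        proof (cases "j = k \<and> Suc j \<in> \<Lambda> \<and> t = \<tau> (Suc j)")
          case True
          then have "?jump j" using JQ jkt by blast
          then show ?thesis using True \<rho>[of "Suc j"] by metis
        next
          case False
          then have "?succ j (k, t) = {}" using JQ jkt by blast
          then show ?thesis using False by simp
        qed
      qed
    qed
    ultimately show ?thesis by (simp only:)
  qed
  have flow: "?cont j t \<longleftrightarrow>
      tangent_map (?D (\<rho> j)) (c j) (unit_field (\<tau> j) (\<tau> (Suc j)) t) = vfield H (\<rho> j) (c j t)"
    if j: "j \<in> \<Lambda>" "t \<in> ?I j" and sm: "\<And>s. s \<in> ?I j \<Longrightarrow> fst (cpart \<psi> (j, s)) = \<rho> j" for j t
  proof -
    have "\<rho> j \<in> ?V" "c j t \<in> mcarrier (?D (\<rho> j))"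
      unfolding c[OF j] sm[OF j(2), symmetric] using target[OF j] by blast+
    moreover have "manifold (?D (\<rho> j))" "vector_field (?D (\<rho> j)) (vfield H (\<rho> j))"
      using assms(1) \<open>\<rho> j \<in> ?V\<close> by (auto simp: is_hybrid_system_def)
    moreover have "cpart \<psi> (j, s) = (\<rho> j, c j s)" if "s \<in> ?I j" for s
      using sm[OF that] c[OF j(1) that] by (metis prod.collapse)
    ultimately show ?thesis
      using integral_curve_in_summand[of j \<Lambda> "\<rho> j" ?V ?D "vfield H" t \<tau> "\<lambda>j. \<tau> (Suc j)"
          "c j" "cpart \<psi>"] j
      by (simp add: clock_coalgebra_def system_coalgebra_def)
  qed
  have jump: "?jump j \<longleftrightarrow> ?edge j \<and> dpart \<psi> (j, (j, \<tau> (Suc j))) = \<rho> j \<and>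
      fst (cpart \<psi> (Suc j, \<tau> (Suc j))) = \<rho> (Suc j)"
    if j: "j \<in> \<Lambda>" "Suc j \<in> \<Lambda>" and sm: "fst (cpart \<psi> (j, \<tau> (Suc j))) = \<rho> j" for j
  proof -
    have "c j (\<tau> (Suc j)) = snd (cpart \<psi> (j, \<tau> (Suc j)))"
      "c (Suc j) (\<tau> (Suc j)) = snd (cpart \<psi> (Suc j, \<tau> (Suc j)))"
      using c[OF j(1)] c[OF j(2)] less[OF j(1)] less[OF j(2)] by simp_all
    then show ?thesis
      unfolding successors_eq_singleton_iff[OF assms(2)]
      using sm by (auto simp: prod_eq_iff)
  qed
  have start: "fst (cpart \<psi> (j, t)) = \<rho> j" if "?J" "j \<in> \<Lambda>" "t \<in> ?I j" for j t
  proof -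
    \<comment> \<open>The head of the edge that is taken occurs in both components of the successor, so a jump
      makes state and summand agree whatever they were before it.\<close>
    have "fst (cpart \<psi> (j, \<tau> j)) = \<rho> j"
    proof (cases j)
      case 0
      then show ?thesis using initial that by simp
    next
      case (Suc k)
      then have "?jump k" using that prev by blast
      then show ?thesis
        unfolding successors_eq_singleton_iff[OF assms(2)] using Suc by auto
    qed
    then show ?thesis using summand[of j t "\<tau> j"] that less[of j] by simp
  qed
  have conj_regroup: "A \<and> B \<and> C \<longleftrightarrow> A' \<and> B' \<and> B'' \<and> C'"
    if "A \<and> B \<longleftrightarrow> A' \<and> B' \<and> B''" and "C' \<longleftrightarrow> C" for A B C A' B' B'' C'
    using that by blast
  show ?thesis (is "_ \<longleftrightarrow> ?F \<and> ?E \<and> ?R \<and> ?N")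
  proof -
    have N: "?N \<longleftrightarrow> ?Q" by (simp only: successors_empty_iff)
    have "?C \<and> ?J \<longleftrightarrow> ?F \<and> ?E \<and> ?R"
    proof
      assume CJ: "?C \<and> ?J"
      then have sm: "fst (cpart \<psi> (j, t)) = \<rho> j" if "j \<in> \<Lambda>" "t \<in> ?I j" for j t
        using start that by blast
      then have ?F using CJ flow by blast
      moreover have "?edge j \<and> dpart \<psi> (j, (j, \<tau> (Suc j))) = \<rho> j"
        if "j \<in> \<Lambda>" "Suc j \<in> \<Lambda>" for j
        using jump[OF that sm] CJ that less[of j] by auto
      ultimately show "?F \<and> ?E \<and> ?R" by blast
    next
      assume R: "?F \<and> ?E \<and> ?R"
      then have sm: "fst (cpart \<psi> (j, t)) = \<rho> j" if "j \<in> \<Lambda>" "t \<in> ?I j" for j t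
        using that by blast
      then have ?C using R flow by blast
      moreover have "?jump j" if "j \<in> \<Lambda>" "Suc j \<in> \<Lambda>" for j
      proof -
        have "fst (cpart \<psi> (j, \<tau> (Suc j))) = \<rho> j"
          "fst (cpart \<psi> (Suc j, \<tau> (Suc j))) = \<rho> (Suc j)"
          using sm that less[of j] less[of "Suc j"] by simp_all
        moreover have "?edge j" "dpart \<psi> (j, (j, \<tau> (Suc j))) = \<rho> j" using R that by blast+
        ultimately show ?thesis using jump[OF that] by blast
      qed
      ultimately show "?C \<and> ?J" by blast
    qed
    from trans[OF morphism conj_regroup[OF this N]] show ?thesis .
  qed
qed

end
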